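(* Let $I$ be an ideal of $R[x_1,\dots,x_n]$. Then the set $GB$ constructed from $I$ as described in the context is finite.
   Context: Ring and reduction. $R$ is a commutative ring with $1$. There is a reduction relation on $R$: for $a,c\in R$ and a finite nonempty set $\{b_1,\dots,b_k\}\subseteq R$ one may have "$a\to c$ using $\{b_1,\dots,b_k\}$" (if $k=1$: "$a\to c$ by $b_1$"). We say $a$ reduces using (or by) a set if $a\to c$ using it for some $c$. For $B\subseteq R$, a reduction step using $B$ is a step using some finite nonempty subset of $B$; $a$ is in normal form using $B$ if no reduction step using $B$ applies to it; a normal form of $a$ using $B$ is an element in normal form reachable from $a$ by finitely many (possibly zero) steps using $B$. The relation $\to$ (steps using arbitrary elements of $R$) is well-founded, i.e. there is no infinite sequence of steps, and satisfies: (i) a nonzero $a$ reduces to $0$ by $b$ if $a$ is a multiple of $b$; (ii) if $a\to c$ using $\{b_1,\dots,b_k\}$ then $a-c\in(b_1,\dots,b_k)$; (iii) if $a$ reduces using $\{b_1,\dots,b_k\}$ and each $b_i$ reduces by $\{c_1,\dots,c_j\}$, then $a$ also reduces by $\{c_1,\dots,c_j\}$. A basis (generating set) $B$ of an ideal of $R$ is a weak Gröbner basis if every element of the ideal has $0$ as a normal form using $B$. Every ideal of $R$ is assumed to have a finite weak Gröbner basis. Orderings. Terms are power products of $x_1,\dots,x_n$, with a fixed admissible total well-ordering (compatible with multiplication, $1$ least). A monomial is $ct$ with $c\in R$ nonzero and $t$ a term. For nonzero $p\in R[x_1,\dots,x_n]$, $HD(p)$, $HT(p)$, $HC(p)$ are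 its head-monomial, head-term, head-coefficient, so $HD(p)=HC(p)\cdot HT(p)$, and $Rest(p)=p-HD(p)$; these functions apply elementwise to sets (for an ideal, to its nonzero elements). On $R$ put $a<c$ iff there is a nonempty reduction sequence $c\to c_1\to\dots\to a$. On monomials, $ct<c't'$ iff $t<t'$, or $t=t'$ and $c<c'$. On polynomials, $p<q$ iff $p=0\neq q$, or $p,q\ne0$ and either $HD(p)<HD(q)$, or $HD(p)=HD(q)$ and $Rest(p)<Rest(q)$. Minimal monomials. For a set $M$ of monomials, $MinMon(M)$ is the set of $m\in M$ such that no $m'\in M$ properly divides $m$ (i.e. $m'\mid m$ but $m\nmid m'$). For $t\in HT(MinMon(HD(I)))$, $D(t,I)$ is the set of all coefficients of $t$ in $MinMon(HD(I))$. Construction of $GB$. For each $t\in HT(MinMon(HD(I)))$ let $G(t,I)$ be a finite weak Gröbner basis of the ideal of $R$ generated by $D(t,I)$. For each nonzero $g\in G(t,I)$, include in $GB$ one polynomial of $I$ which is minimal with respect to $<$ among the polynomials in $I$ with head-monomial $g\cdot t$. *)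

theory Defs
  imports Complex_Main "HOL-Library.Poly_Mapping"
begin

section \<open>Ideals of commutative rings\<close>

text \<open>An ideal is a submodule of the ring regarded as a module over itself.\<close>

abbreviation is_ideal :: "'r::comm_ring_1 set \<Rightarrow> bool" where
  "is_ideal \<equiv> module.subspace (*)"

abbreviation ideal_gen :: "'r::comm_ring_1 set \<Rightarrow> 'r set" where
  "ideal_gen \<equiv> module.span (*)"


section \<open>Reduction rings\<close>

text \<open>\<open>red a S c\<close> means that \<open>a \<rightarrow> c\<close> using exactly the set \<open>S\<close>.\<close>

context
  fixes red :: "'r::comm_ring_1 \<Rightarrow> 'r set \<Rightarrow> 'r \<Rightarrow> bool"
begin

definition reduces :: "'r \<Rightarrow> 'r set \<Rightarrow> bool" where
  "reduces a S \<longleftrightarrow> (\<exists>c. red a S c)"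

definition step :: "'r set \<Rightarrow> 'r \<Rightarrow> 'r \<Rightarrow> bool" where
  "step B a c \<longleftrightarrow> (\<exists>S. finite S \<and> S \<noteq> {} \<and> S \<subseteq> B \<and> red a S c)"

definition in_normal_form :: "'r set \<Rightarrow> 'r \<Rightarrow> bool" where
  "in_normal_form B a \<longleftrightarrow> \<not> (\<exists>c. step B a c)"

definition normal_form_of :: "'r set \<Rightarrow> 'r \<Rightarrow> 'r \<Rightarrow> bool" where
  "normal_form_of B a c \<longleftrightarrow> (step B)\<^sup>*\<^sup>* a c \<and> in_normal_form B c"

definition weak_groebner_basis :: "'r set \<Rightarrow> 'r set \<Rightarrow> bool" where
  "weak_groebner_basis J B \<longleftrightarrow> ideal_gen B = J \<and> (\<forall>a\<in>J. normal_form_of B a 0)"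

definition ring_less :: "'r \<Rightarrow> 'r \<Rightarrow> bool" where
  "ring_less a c \<longleftrightarrow> (step UNIV)\<^sup>+\<^sup>+ c a"

end

locale reduction_ring =
  fixes red :: "'r::comm_ring_1 \<Rightarrow> 'r set \<Rightarrow> 'r \<Rightarrow> bool"
  assumes red_finite_nonempty: "red a S c \<Longrightarrow> finite S \<and> S \<noteq> {}"
    and wf_step: "wfp (\<lambda>c a. step red UNIV a c)"
    and red_multiple: "a \<noteq> 0 \<Longrightarrow> b dvd a \<Longrightarrow> red a {b} 0"
    and red_diff_in_ideal: "red a S c \<Longrightarrow> a - c \<in> ideal_gen S"
    and reduces_trans: "reduces red a S \<Longrightarrow> (\<And>b. b \<in> S \<Longrightarrow> reduces red b T) \<Longrightarrow> reduces red a T"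
    and ex_finite_weak_groebner_basis:
      "is_ideal J \<Longrightarrow> \<exists>B. finite B \<and> weak_groebner_basis red J B"


section \<open>Polynomials\<close>

text \<open>
  The indeterminates are the elements of a finite type \<open>'x\<close>.  Terms are identified with their
  exponent vectors, so that multiplication of terms is addition and the term 1 is the zero vector.
\<close>

type_synonym 'x trm = "'x \<Rightarrow>\<^sub>0 nat"
type_synonym ('x, 'r) mpoly = "'x trm \<Rightarrow>\<^sub>0 'r"

locale admissible_order = wellorder le less
  for le :: "'x::finite trm \<Rightarrow> 'x trm \<Rightarrow> bool" and less :: "'x trm \<Rightarrow> 'x trm \<Rightarrow> bool" +
  assumes le_add_right: "le s t \<Longrightarrow> le (s + u) (t + u)"
    and zero_le: "le 0 t"

context
  fixes le :: "'x::finite trm \<Rightarrow> 'x trm \<Rightarrow> bool"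
begin

text \<open>
  These are meaningful for nonzero polynomials only.  The monomial \<open>c t\<close> is the polynomial
  \<open>Poly_Mapping.single t c\<close> with \<open>c \<noteq> 0\<close>.
\<close>

definition HT :: "('x, 'r::comm_ring_1) mpoly \<Rightarrow> 'x trm" where
  "HT p = (THE t. t \<in> Poly_Mapping.keys p \<and> (\<forall>s\<in>Poly_Mapping.keys p. le s t))"

definition HC :: "('x, 'r::comm_ring_1) mpoly \<Rightarrow> 'r" where
  "HC p = Poly_Mapping.lookup p (HT p)"

definition HD :: "('x, 'r::comm_ring_1) mpoly \<Rightarrow> ('x, 'r) mpoly" where
  "HD p = Poly_Mapping.single (HT p) (HC p)"

definition Rest :: "('x, 'r::comm_ring_1) mpoly \<Rightarrow> ('x, 'r) mpoly" where
  "Rest p = p - HD p"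

definition HDs :: "('x, 'r::comm_ring_1) mpoly set \<Rightarrow> ('x, 'r) mpoly set" where
  "HDs I = HD ` (I - {0})"

end

context
  fixes red :: "'r::comm_ring_1 \<Rightarrow> 'r set \<Rightarrow> 'r \<Rightarrow> bool"
    and le less :: "'x::finite trm \<Rightarrow> 'x trm \<Rightarrow> bool"
begin

definition monomial_less :: "('x, 'r) mpoly \<Rightarrow> ('x, 'r) mpoly \<Rightarrow> bool" where
  "monomial_less m m' \<longleftrightarrow>
     less (HT le m) (HT le m') \<or>
     HT le m = HT le m' \<and> ring_less red (HC le m) (HC le m')"

text \<open>
  \<open>Rest\<close> strictly lowers the head term, so the recursive characterization of the
  order has only one solution and taking the least one involves no choice.
\<close>

inductive poly_less :: "('x, 'r) mpoly \<Rightarrow> ('x, 'r) mpoly \<Rightarrow> bool" where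
  zero: "q \<noteq> 0 \<Longrightarrow> poly_less 0 q"
| head: "p \<noteq> 0 \<Longrightarrow> q \<noteq> 0 \<Longrightarrow> monomial_less (HD le p) (HD le q) \<Longrightarrow> poly_less p q"
| rest: "p \<noteq> 0 \<Longrightarrow> q \<noteq> 0 \<Longrightarrow> HD le p = HD le q \<Longrightarrow> poly_less (Rest le p) (Rest le q)
    \<Longrightarrow> poly_less p q"

end


section \<open>The construction of GB\<close>

definition MinMon :: "('x::finite, 'r::comm_ring_1) mpoly set \<Rightarrow> ('x, 'r) mpoly set" where
  "MinMon M = {m \<in> M. \<not> (\<exists>m'\<in>M. m' dvd m \<and> \<not> m dvd m')}"

definition minimal_terms ::
    "('x::finite trm \<Rightarrow> 'x trm \<Rightarrow> bool) \<Rightarrow> ('x, 'r::comm_ring_1) mpoly set \<Rightarrow> 'x trm set" where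
  "minimal_terms le I = HT le ` MinMon (HDs le I)"

definition D ::
    "('x::finite trm \<Rightarrow> 'x trm \<Rightarrow> bool) \<Rightarrow> 'x trm \<Rightarrow> ('x, 'r::comm_ring_1) mpoly set \<Rightarrow> 'r set" where
  "D le t I = {c. Poly_Mapping.single t c \<in> MinMon (HDs le I)}"

context
  fixes red :: "'r::comm_ring_1 \<Rightarrow> 'r set \<Rightarrow> 'r \<Rightarrow> bool"
    and le less :: "'x::finite trm \<Rightarrow> 'x trm \<Rightarrow> bool"
begin

definition minimal_with_head :: "('x, 'r) mpoly set \<Rightarrow> ('x, 'r) mpoly \<Rightarrow> ('x, 'r) mpoly \<Rightarrow> bool" where
  "minimal_with_head I m p \<longleftrightarrow>
     p \<in> I \<and> p \<noteq> 0 \<and> HD le p = m \<and>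
     \<not> (\<exists>q\<in>I. q \<noteq> 0 \<and> HD le q = m \<and> poly_less red le less q p)"

text \<open>
  The construction involves choices: the weak bases \<open>G t\<close>, and for each \<open>t\<close> and
  \<open>g\<close> a minimal polynomial \<open>f t g\<close>.  The predicate holds for every set that arises
  from some admissible choice.
\<close>

definition constructed_GB :: "('x, 'r) mpoly set \<Rightarrow> ('x, 'r) mpoly set \<Rightarrow> bool" where
  "constructed_GB I GB \<longleftrightarrow>
     (\<exists>(G :: 'x trm \<Rightarrow> 'r set) (f :: 'x trm \<Rightarrow> 'r \<Rightarrow> ('x, 'r) mpoly).
        (\<forall>t \<in> minimal_terms le I.
           finite (G t) \<and> weak_groebner_basis red (ideal_gen (D le t I)) (G t)) \<and>
        (\<forall>t \<in> minimal_terms le I. \<forall>g \<in> G t - {0}.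
           minimal_with_head I (Poly_Mapping.single t g) (f t g)) \<and>
        GB = {f t g | t g. t \<in> minimal_terms le I \<and> g \<in> G t - {0}})"

end

end

theory Submission
  imports Defs
begin

text \<open>
  Each minimal term contributes one polynomial for each nonzero element of a finite weak basis, so
  everything rests on there being only finitely many minimal terms (\<open>finite_minimal_terms\<close>).

  For a term \<open>t\<close>, the coefficients of \<open>t\<close> in those elements of the ideal that have no term above
  \<open>t\<close> form an ideal \<open>J\<^sub>t\<close> of the coefficient ring: it consists of 0 and the head-coefficients
  of the elements with head-term \<open>t\<close> (\<open>single_in_HDs_iff\<close>). Multiplication by a term shows that
  \<open>J\<^sub>s \<subseteq> J\<^sub>t\<close> if \<open>s\<close> divides \<open>t\<close> (\<open>head_coeff_ideal_mono\<close>). If \<open>c t\<close> is a minimal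
  head-monomial and \<open>s\<close> is a proper divisor of \<open>t\<close>, then \<open>c \<notin> J\<^sub>s\<close>, since otherwise
  \<open>c s\<close> would be a head-monomial dividing \<open>c t\<close> properly. So \<open>J\<^sub>s\<close> is a proper subset of
  \<open>J\<^sub>t\<close> whenever \<open>t\<close> is minimal (\<open>minimal_term_new_head_coeff\<close>).

  Infinitely many minimal terms would contain a sequence in which each term properly divides the
  next (Dickson's lemma, \<open>infinite_terms_division_chain\<close>), hence would give a strictly increasing
  sequence of ideals of the coefficient ring. There is none: weak bases generate, so the ring is
  Noetherian (\<open>ideal_chain_stabilizes\<close>).
\<close>

section \<open>Dickson's lemma\<close>

lemma nat_seq_mono_subseq:
  fixes s :: "nat \<Rightarrow> nat"
  shows "\<exists>\<phi> :: nat \<Rightarrow> nat. strict_mono \<phi> \<and> mono (\<lambda>n. s (\<phi> n))"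
proof -
  obtain \<phi> where \<phi>: "strict_mono \<phi>" and mon: "monoseq (\<lambda>n. s (\<phi> n))"
    using seq_monosub by blast
  show ?thesis
  proof (cases "mono (\<lambda>n. s (\<phi> n))")
    case True
    then show ?thesis using \<phi> by blast
  next
    case False
    then have anti: "s (\<phi> n) \<le> s (\<phi> m)" if "m \<le> n" for m n
      using mon that unfolding monoseq_def mono_def by blast
    \<comment> \<open>A decreasing sequence of naturals is constant from the index of its least value on.\<close>
    obtain N where N: "\<And>n. s (\<phi> N) \<le> s (\<phi> n)"
      using ex_has_least_nat[of "\<lambda>_. True" 0 "\<lambda>n. s (\<phi> n)"] by auto
    have "mono (\<lambda>n. s (\<phi> (N + n)))"
      by (intro monoI) (meson N anti le_add1 order_trans)
    moreover have "strict_mono (\<lambda>n. \<phi> (N + n))"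
      using \<phi> by (auto simp: strict_mono_def)
    ultimately show ?thesis by blast
  qed
qed

text \<open>
  One coordinate after the other, pass to a subsequence that is increasing there; monotonicity
  in the earlier coordinates survives.
\<close>

lemma nat_vector_seq_mono_subseq:
  fixes f :: "nat \<Rightarrow> 'a \<Rightarrow> nat"
  assumes "finite A"
  shows "\<exists>\<phi> :: nat \<Rightarrow> nat. strict_mono \<phi> \<and> (\<forall>a\<in>A. mono (\<lambda>n. f (\<phi> n) a))"
  using assms
proof induction
  case empty
  have "strict_mono (id :: nat \<Rightarrow> nat)" by (rule strict_mono_id)
  then show ?case by blast
next
  case (insert x A)
  then obtain \<phi> :: "nat \<Rightarrow> nat"
    where \<phi>: "strict_mono \<phi>" "\<forall>a\<in>A. mono (\<lambda>n. f (\<phi> n) a)" by blast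
  obtain \<psi> :: "nat \<Rightarrow> nat"
    where \<psi>: "strict_mono \<psi>" "mono (\<lambda>n. f (\<phi> (\<psi> n)) x)"
    using nat_seq_mono_subseq[of "\<lambda>n. f (\<phi> n) x"] by blast
  have "strict_mono (\<lambda>n. \<phi> (\<psi> n))"
    using \<phi>(1) \<psi>(1) by (auto simp: strict_mono_def)
  moreover have "mono (\<lambda>n. f (\<phi> (\<psi> n)) a)" if "a \<in> A" for a
    using \<phi>(2) \<psi>(1) that by (auto simp: mono_def strict_mono_less_eq)
  ultimately show ?case using \<psi>(2) by blast
qed

lemma infinite_terms_division_chain:
  fixes T :: "'x::finite trm set"
  assumes "infinite T"
  shows "\<exists>t :: nat \<Rightarrow> 'x trm. range t \<subseteq> T \<and> (\<forall>i. \<exists>u. u \<noteq> 0 \<and> t (Suc i) = u + t i)"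
proof -
  obtain e :: "nat \<Rightarrow> 'x trm" where e: "inj e" "range e \<subseteq> T"
    using assms infinite_countable_subset by blast
  obtain \<phi> :: "nat \<Rightarrow> nat"
    where \<phi>: "strict_mono \<phi>" "\<And>x. mono (\<lambda>n. Poly_Mapping.lookup (e (\<phi> n)) x)"
    using nat_vector_seq_mono_subseq[of UNIV "\<lambda>n. Poly_Mapping.lookup (e n)"] by auto
  define t where "t n = e (\<phi> n)" for n
  have "\<exists>u. u \<noteq> 0 \<and> t (Suc i) = u + t i" for i
  proof (intro exI conjI)
    show eq: "t (Suc i) = (t (Suc i) - t i) + t i"
      using \<phi>(2) unfolding t_def
      by (intro poly_mapping_eqI) (simp add: lookup_add lookup_minus mono_def)
    have "\<phi> i \<noteq> \<phi> (Suc i)"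
      using \<phi>(1) by (simp add: strict_mono_eq)
    then have "t i \<noteq> t (Suc i)"
      using e(1) by (auto simp: t_def dest: injD)
    then show "t (Suc i) - t i \<noteq> 0"
      using eq by auto
  qed
  moreover have "range t \<subseteq> T"
    using e(2) by (auto simp: t_def)
  ultimately show ?thesis by blast
qed


section \<open>Ascending chains of ideals\<close>

interpretation self_module: module "(*) :: 'r::comm_ring_1 \<Rightarrow> 'r \<Rightarrow> 'r"
  by unfold_locales (simp_all add: algebra_simps)

lemma is_ideal_Union_chain:
  fixes J :: "nat \<Rightarrow> 'r::comm_ring_1 set"
  assumes ideal: "\<And>i. is_ideal (J i)" and "mono J"
  shows "is_ideal (\<Union>i. J i)"
proof (rule self_module.subspaceI)
  show "0 \<in> (\<Union>i. J i)"
    using ideal self_module.subspace_0 by blast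
next
  fix x y assume "x \<in> (\<Union>i. J i)" "y \<in> (\<Union>i. J i)"
  then obtain i j where "x \<in> J i" "y \<in> J j" by blast
  then have "x \<in> J (max i j)" "y \<in> J (max i j)"
    using monoD[OF \<open>mono J\<close>] by (meson max.cobounded1 max.cobounded2 subsetD)+
  then show "x + y \<in> (\<Union>i. J i)"
    using ideal self_module.subspace_add by blast
next
  fix c x assume "x \<in> (\<Union>i. J i)"
  then show "c * x \<in> (\<Union>i. J i)"
    using ideal self_module.subspace_scale by blast
qed

text \<open>Finitely many generators of the union of the chain lie in a single member of it.\<close>

lemma ideal_chain_stabilizes:
  fixes J :: "nat \<Rightarrow> 'r::comm_ring_1 set"
  assumes noetherian: "\<And>K :: 'r set. is_ideal K \<Longrightarrow> \<exists>B. finite B \<and> ideal_gen B = K"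
    and ideal: "\<And>i. is_ideal (J i)" and "mono J"
  shows "\<exists>N. J (Suc N) \<subseteq> J N"
proof -
  obtain B where B: "finite B" "ideal_gen B = (\<Union>i. J i)"
    using noetherian[OF is_ideal_Union_chain[OF ideal \<open>mono J\<close>]] by blast
  have "\<forall>b\<in>B. \<exists>i. b \<in> J i"
    using self_module.span_superset[of B] unfolding B(2) by blast
  then obtain k where k: "\<And>b. b \<in> B \<Longrightarrow> b \<in> J (k b)"
    by metis
  define N where "N = Max (insert 0 (k ` B))"
  have "B \<subseteq> J N"
  proof
    fix b assume "b \<in> B"
    then have "k b \<le> N"
      using B(1) by (simp add: N_def)
    then show "b \<in> J N"
      using k[OF \<open>b \<in> B\<close>] monoD[OF \<open>mono J\<close>] by blast
  qed
  then have "ideal_gen B \<subseteq> J N"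
    by (rule self_module.span_minimal) (rule ideal)
  then show ?thesis
    unfolding B(2) by blast
qed

context reduction_ring
begin

lemma ideal_finitely_generated:
  fixes K :: "'r set"
  shows "is_ideal K \<Longrightarrow> \<exists>B. finite B \<and> ideal_gen B = K"
  using ex_finite_weak_groebner_basis[of K] unfolding weak_groebner_basis_def by blast

end


section \<open>Products with monomials\<close>

lemma lookup_single_mult:
  fixes p :: "('x, 'r::comm_ring_1) mpoly"
  shows "Poly_Mapping.lookup (Poly_Mapping.single u c * p) (u + t) = c * Poly_Mapping.lookup p t"
  by (simp add: lookup_mult lookup_single when_mult)

lemma keys_single_mult:
  fixes p :: "('x, 'r::comm_ring_1) mpoly"
  assumes "s \<in> Poly_Mapping.keys (Poly_Mapping.single u c * p)"
  shows "\<exists>r \<in> Poly_Mapping.keys p. s = u + r"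
proof -
  obtain a r where "s = a + r" "a \<in> Poly_Mapping.keys (Poly_Mapping.single u c)"
    and "r \<in> Poly_Mapping.keys p"
    using assms keys_mult[of "Poly_Mapping.single u c" p] by blast
  then show ?thesis
    by (auto split: if_splits)
qed

text \<open>
  Zero divisors among the coefficients do no harm here: every term of a multiple of a monomial is
  a multiple of its term, whatever the coefficients are.
\<close>

lemma single_not_dvd_of_proper_divisor:
  fixes c d :: "'r::comm_ring_1" and t u :: "'x trm"
  assumes "c \<noteq> 0" "u \<noteq> 0"
  shows "\<not> Poly_Mapping.single (u + t) d dvd Poly_Mapping.single t c"
proof
  assume "Poly_Mapping.single (u + t) d dvd Poly_Mapping.single t c"
  then obtain q where "Poly_Mapping.single t c = Poly_Mapping.single (u + t) d * q" ..
  moreover have "t \<in> Poly_Mapping.keys (Poly_Mapping.single t c)"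
    using assms(1) by simp
  ultimately obtain v where "t = u + t + v"
    using keys_single_mult by metis
  then have "t + 0 = t + (u + v)"
    by (simp add: ac_simps)
  then have "Poly_Mapping.lookup (u + v) x = 0" for x
    by (metis add_left_cancel lookup_zero)
  then have "u = 0"
    by (intro poly_mapping_eqI) (simp add: lookup_add)
  then show False using assms(2) by simp
qed


section \<open>Ideals of head-coefficients\<close>

text \<open>
  Admitting all elements without a term above \<open>t\<close>, instead of only those with head-term \<open>t\<close>,
  includes the coefficient 0 and makes the set visibly closed under addition and scaling.
\<close>

definition head_coeff_ideal ::
    "('x::finite trm \<Rightarrow> 'x trm \<Rightarrow> bool) \<Rightarrow> ('x, 'r::comm_ring_1) mpoly set \<Rightarrow> 'x trm \<Rightarrow> 'r set" where
  "head_coeff_ideal le I t =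
     {Poly_Mapping.lookup p t | p. p \<in> I \<and> (\<forall>s\<in>Poly_Mapping.keys p. le s t)}"

context admissible_order
begin

lemma HT_eq_iff:
  fixes p :: "('x, 'r::comm_ring_1) mpoly"
  assumes "p \<noteq> 0"
  shows "HT le p = t \<longleftrightarrow> t \<in> Poly_Mapping.keys p \<and> (\<forall>s\<in>Poly_Mapping.keys p. le s t)"
proof -
  have greatest: "\<exists>t\<in>K. \<forall>s\<in>K. le s t" if "finite K" "K \<noteq> {}" for K
    using that
  proof (induction rule: finite_ne_induct)
    case (singleton x)
    then show ?case by simp
  next
    case (insert x F)
    then obtain t where "t \<in> F" "\<forall>s\<in>F. le s t" by blast
    then show ?case
      by (metis insert_iff linear order.refl order.trans)
  qed
  have "\<exists>!t. t \<in> Poly_Mapping.keys p \<and> (\<forall>s\<in>Poly_Mapping.keys p. le s t)"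
    using greatest[of "Poly_Mapping.keys p"] assms by (auto intro: order.antisym)
  from theI'[OF this] this show ?thesis
    unfolding HT_def by blast
qed

lemma HT_single:
  fixes c :: "'r::comm_ring_1"
  assumes "c \<noteq> 0"
  shows "HT le (Poly_Mapping.single t c) = t"
proof -
  have "Poly_Mapping.single t c \<noteq> 0"
    using assms by (metis lookup_single_eq lookup_zero)
  then show ?thesis
    using assms by (simp add: HT_eq_iff)
qed

lemma HC_nonzero: "p \<noteq> 0 \<Longrightarrow> HC le p \<noteq> 0"
  using HT_eq_iff[of p "HT le p"] by (simp add: HC_def in_keys_iff)

lemma single_in_HDs_iff:
  assumes "c \<noteq> 0"
  shows "Poly_Mapping.single t c \<in> HDs le I \<longleftrightarrow> c \<in> head_coeff_ideal le I t"
proof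
  assume "Poly_Mapping.single t c \<in> HDs le I"
  then obtain p where p: "p \<in> I" "p \<noteq> 0"
    and eq: "Poly_Mapping.single t c = Poly_Mapping.single (HT le p) (HC le p)"
    by (auto simp: HDs_def HD_def)
  have "HT le p = t"
    using arg_cong[OF eq, of "HT le"] assms HC_nonzero[OF p(2)] by (simp add: HT_single)
  with eq have "c = Poly_Mapping.lookup p t"
    by (auto simp: HC_def dest: injD[OF inj_single])
  moreover have "\<forall>s\<in>Poly_Mapping.keys p. le s t"
    using \<open>HT le p = t\<close> HT_eq_iff[OF p(2)] by blast
  ultimately show "c \<in> head_coeff_ideal le I t"
    using p(1) unfolding head_coeff_ideal_def by blast
next
  assume "c \<in> head_coeff_ideal le I t"
  then obtain p where p: "p \<in> I" "c = Poly_Mapping.lookup p t"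
    and bound: "\<forall>s\<in>Poly_Mapping.keys p. le s t"
    unfolding head_coeff_ideal_def by blast
  have "t \<in> Poly_Mapping.keys p"
    using assms p(2) by (simp add: in_keys_iff)
  then have "p \<noteq> 0" by auto
  then have "HT le p = t"
    using HT_eq_iff \<open>t \<in> Poly_Mapping.keys p\<close> bound by blast
  then have "HD le p = Poly_Mapping.single t c"
    by (simp add: HD_def HC_def p(2))
  then show "Poly_Mapping.single t c \<in> HDs le I"
    using p(1) \<open>p \<noteq> 0\<close> unfolding HDs_def by (metis Diff_iff imageI singletonD)
qed

lemma is_ideal_head_coeff_ideal:
  fixes I :: "('x, 'r::comm_ring_1) mpoly set"
  assumes "is_ideal I"
  shows "is_ideal (head_coeff_ideal le I t)"
proof (rule self_module.subspaceI)
  show "0 \<in> head_coeff_ideal le I t"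
    unfolding head_coeff_ideal_def
    using self_module.subspace_0[OF assms] by (auto intro!: exI[of _ 0])
next
  fix x y assume "x \<in> head_coeff_ideal le I t" "y \<in> head_coeff_ideal le I t"
  then obtain p q where p: "p \<in> I" "x = Poly_Mapping.lookup p t" "\<forall>s\<in>Poly_Mapping.keys p. le s t"
    and q: "q \<in> I" "y = Poly_Mapping.lookup q t" "\<forall>s\<in>Poly_Mapping.keys q. le s t"
    unfolding head_coeff_ideal_def by blast
  have "\<forall>s\<in>Poly_Mapping.keys (p + q). le s t"
    using keys_add[of p q] p(3) q(3) by blast
  moreover have "p + q \<in> I"
    using self_module.subspace_add[OF assms] p(1) q(1) by blast
  ultimately show "x + y \<in> head_coeff_ideal le I t"
    unfolding head_coeff_ideal_def p(2) q(2) lookup_add[symmetric] by blast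
next
  fix c x assume "x \<in> head_coeff_ideal le I t"
  then obtain p where p: "p \<in> I" "x = Poly_Mapping.lookup p t" "\<forall>s\<in>Poly_Mapping.keys p. le s t"
    unfolding head_coeff_ideal_def by blast
  let ?q = "Poly_Mapping.single 0 c * p"
  have "c * x = Poly_Mapping.lookup ?q t"
    using lookup_single_mult[of 0 c p t] p(2) by simp
  moreover have "\<forall>s\<in>Poly_Mapping.keys ?q. le s t"
    using keys_single_mult[of _ 0 c p] p(3) by auto
  moreover have "?q \<in> I"
    using self_module.subspace_scale[OF assms p(1)] .
  ultimately show "c * x \<in> head_coeff_ideal le I t"
    unfolding head_coeff_ideal_def by blast
qed

lemma head_coeff_ideal_mono:
  fixes I :: "('x, 'r::comm_ring_1) mpoly set"
  assumes "is_ideal I"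
  shows "head_coeff_ideal le I t \<subseteq> head_coeff_ideal le I (u + t)"
proof
  fix c assume "c \<in> head_coeff_ideal le I t"
  then obtain p where p: "p \<in> I" "c = Poly_Mapping.lookup p t" "\<forall>s\<in>Poly_Mapping.keys p. le s t"
    unfolding head_coeff_ideal_def by blast
  let ?q = "Poly_Mapping.single u 1 * p"
  have "c = Poly_Mapping.lookup ?q (u + t)"
    using lookup_single_mult[of u 1 p t] p(2) by simp
  moreover have "\<forall>s\<in>Poly_Mapping.keys ?q. le s (u + t)"
    using keys_single_mult[of _ u 1 p] p(3) by (metis add.commute le_add_right)
  moreover have "?q \<in> I"
    using self_module.subspace_scale[OF assms p(1)] .
  ultimately show "c \<in> head_coeff_ideal le I (u + t)"
    unfolding head_coeff_ideal_def by blast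
qed

text \<open>
  The new coefficient is that of a minimal head-monomial with term \<open>u + t\<close>: were it to occur
  at \<open>t\<close> already, the head-monomial there would be a proper divisor.
\<close>

lemma minimal_term_new_head_coeff:
  fixes I :: "('x, 'r::comm_ring_1) mpoly set"
  assumes minimal: "u + t \<in> minimal_terms le I" and "u \<noteq> 0"
  shows "\<not> head_coeff_ideal le I (u + t) \<subseteq> head_coeff_ideal le I t"
proof -
  obtain m where m: "m \<in> MinMon (HDs le I)" "HT le m = u + t"
    using minimal unfolding minimal_terms_def by (metis imageE)
  have "m \<in> HDs le I"
    using m(1) unfolding MinMon_def mem_Collect_eq by (rule conjunct1)
  then obtain p where p: "p \<in> I" "p \<noteq> 0" "m = HD le p"
    unfolding HDs_def by (elim imageE DiffE) (rule that, simp_all)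
  define c where "c = HC le p"
  have "c \<noteq> 0"
    using HC_nonzero[OF p(2)] by (simp add: c_def)
  then have m_eq: "m = Poly_Mapping.single (u + t) c"
    using m(2) HT_single[of c "HT le p"] by (simp add: p(3) HD_def flip: c_def)
  have "c \<in> head_coeff_ideal le I (u + t)"
    using \<open>m \<in> HDs le I\<close> single_in_HDs_iff[OF \<open>c \<noteq> 0\<close>] unfolding m_eq by blast
  moreover have "c \<notin> head_coeff_ideal le I t"
  proof
    assume "c \<in> head_coeff_ideal le I t"
    then have "Poly_Mapping.single t c \<in> HDs le I"
      using single_in_HDs_iff[OF \<open>c \<noteq> 0\<close>] by blast
    moreover have "Poly_Mapping.single t c dvd m"
    proof
      show "m = Poly_Mapping.single t c * Poly_Mapping.single u 1"
        by (simp add: m_eq mult_single add.commute)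
    qed
    moreover have "\<not> m dvd Poly_Mapping.single t c"
      unfolding m_eq using single_not_dvd_of_proper_divisor[OF \<open>c \<noteq> 0\<close> \<open>u \<noteq> 0\<close>] .
    ultimately show False
      using m(1) unfolding MinMon_def mem_Collect_eq by blast
  qed
  ultimately show ?thesis by blast
qed

lemma finite_minimal_terms:
  fixes I :: "('x, 'r::comm_ring_1) mpoly set"
  assumes noetherian: "\<And>K :: 'r set. is_ideal K \<Longrightarrow> \<exists>B. finite B \<and> ideal_gen B = K"
    and "is_ideal I"
  shows "finite (minimal_terms le I)"
proof (rule ccontr)
  assume "infinite (minimal_terms le I)"
  then obtain t :: "nat \<Rightarrow> 'x trm"
    where t: "range t \<subseteq> minimal_terms le I" "\<And>i. \<exists>u. u \<noteq> 0 \<and> t (Suc i) = u + t i"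
    using infinite_terms_division_chain by blast
  let ?J = "\<lambda>i. head_coeff_ideal le I (t i)"
  have "?J i \<subseteq> ?J (Suc i)" for i
    using t(2)[of i] head_coeff_ideal_mono[OF \<open>is_ideal I\<close>] by metis
  then have "incseq ?J"
    by (rule incseq_SucI)
  then obtain N where "?J (Suc N) \<subseteq> ?J N"
    using ideal_chain_stabilizes[OF noetherian is_ideal_head_coeff_ideal[OF \<open>is_ideal I\<close>]]
    by blast
  moreover have "t (Suc N) \<in> minimal_terms le I"
    using t(1) by blast
  ultimately show False
    using t(2)[of N] minimal_term_new_head_coeff by metis
qed

end


section \<open>Finiteness of the constructed basis\<close>

theorem theorem5p1:
  fixes red :: "'r::comm_ring_1 \<Rightarrow> 'r set \<Rightarrow> 'r \<Rightarrow> bool"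
    and le less :: "'x::finite trm \<Rightarrow> 'x trm \<Rightarrow> bool"
    and I GB :: "('x, 'r) mpoly set"
  assumes "reduction_ring red"
    and "admissible_order le less"
    and "is_ideal I"
    and "constructed_GB red le less I GB"
  shows "finite GB"
proof -
  obtain G f where fin: "\<forall>t \<in> minimal_terms le I.
      finite (G t) \<and> weak_groebner_basis red (ideal_gen (D le t I)) (G t)"
    and GB: "GB = {f t g | t g. t \<in> minimal_terms le I \<and> g \<in> G t - {0}}"
    using assms(4) unfolding constructed_GB_def by (elim exE conjE) (rule that)
  have "GB = (\<Union>t \<in> minimal_terms le I. f t ` (G t - {0}))"
    unfolding GB by blast
  moreover have "finite (minimal_terms le I)"
    using admissible_order.finite_minimal_terms[OF assms(2) _ assms(3)]
      reduction_ring.ideal_finitely_generated[OF assms(1)] by blast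
  ultimately show ?thesis
    using fin by simp
qed

end
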